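(* Let $M$ be a partially ordered monoid, $(Y,h_Y)$ be an $M$-metric space and $S,T,X,Z$ be some sets. Let $\mathcal{A}\subset X^T$, $\Lambda, I\colon \mathcal{A}\to Y$, $\lambda\colon \mathcal{A}\to Z^S$, and $\varphi\colon \lambda(\mathcal{A})\to M$ be such that the following properties hold. (a) For all $f\in\mathcal{A}$ one has $h_Y(\Lambda f, If)\leq \varphi(\lambda f)$. (b) There exists a subset $\mathcal{B}\subset\mathcal{A}$ such that $h_Y(\Lambda f, If)= \varphi(\lambda f)$ for each $f\in\mathcal{B}$. (c) For some sequence $\{f_n\}\subset \mathcal{B}$ (with $\mathcal{B}$ the subset from (b)) the sequence $\{\varphi(\lambda f_n)\}$ is extremal for the set $\varphi(\lambda(\mathcal{A})):=\{\varphi(\lambda f)\colon f\in\mathcal{A}\}$. Then the sequence $\{h_Y(\Lambda f_n, If_n)\}$ is extremal for the set $\{h_Y(\Lambda f, If)\colon f\in\mathcal{A}\}$.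
   Context: For sets $A,B$, $B^A$ denotes the set of all functions $f\colon A\to B$. A set $M$ with a reflexive, antisymmetric and transitive relation $\leq$ is called partially ordered; $\alpha\ge\beta$ means $\beta\le\alpha$. For a partially ordered set $M$ and $N\subset M$, a sequence $\{x_n\}\subset N$ is called extremal for the set $N$ if, for every $y\in M$, the condition $y\geq x_n$ for all $n\in\mathbb{N}$ implies that $y\geq x$ for all $x\in N$. A monoid is a set $M$ with an associative binary operation $+$ and an element $\theta_M\in M$ such that $\theta_M+\alpha=\alpha=\alpha+\theta_M$ for all $\alpha\in M$. A monoid $M$ is called a partially ordered monoid if it is a partially ordered set, $M_+:=\{\alpha\in M\colon \theta_M\le\alpha\}\neq\{\theta_M\}$, and $\alpha\leq\beta$ implies $\alpha+\gamma\leq\beta+\gamma$ for all $\gamma\in M$. A mapping $h_Y\colon Y\times Y\to M_+$ is called an $M$-valued metric (or $M$-metric), and $(Y,h_Y)$ an $M$-metric space, if for all $x,y,z\in Y$: (1) $x=y$ if and only if $h_Y(x,y)=\theta_M$; (2) $h_Y(x,y)=h_Y(y,x)$; (3) $h_Y(x,y)\le h_Y(x,z)+h_Y(z,y)$. *)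

theory Defs
  imports Main "HOL-Library.FuncSet"
begin

(* Addition need not be commutative, and only right translations are monotone;
   hence the library class ordered_comm_monoid_add is not applicable.
   The monoid M is the whole type, with 0 as its neutral element. *)
class partially_ordered_monoid = monoid_add + order +
  assumes nonneg_nontrivial: "{a. 0 \<le> a} \<noteq> {0}"
    and add_mono_right: "a \<le> b \<Longrightarrow> a + c \<le> b + c"

definition nonneg_part :: "'m::partially_ordered_monoid set" where
  "nonneg_part = {a. 0 \<le> a}"

(* Only the values of h on Y \<times> Y matter; Y may be empty. *)
definition monoid_metric_on ::
    "'y set \<Rightarrow> ('y \<Rightarrow> 'y \<Rightarrow> 'm::partially_ordered_monoid) \<Rightarrow> bool" where
  "monoid_metric_on Y h \<longleftrightarrow>
     (\<forall>x\<in>Y. \<forall>y\<in>Y. h x y \<in> nonneg_part) \<and>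
     (\<forall>x\<in>Y. \<forall>y\<in>Y. x = y \<longleftrightarrow> h x y = 0) \<and>
     (\<forall>x\<in>Y. \<forall>y\<in>Y. h x y = h y x) \<and>
     (\<forall>x\<in>Y. \<forall>y\<in>Y. \<forall>z\<in>Y. h x y \<le> h x z + h z y)"

(* The bound y ranges over the whole ordered set, not only over N. *)
definition extremal_seq :: "'m::order set \<Rightarrow> (nat \<Rightarrow> 'm) \<Rightarrow> bool" where
  "extremal_seq N x \<longleftrightarrow>
     (\<forall>n. x n \<in> N) \<and> (\<forall>y. (\<forall>n. x n \<le> y) \<longrightarrow> (\<forall>z\<in>N. z \<le> y))"

end

theory Submission
  imports Defs
begin

theorem lemma1:
  fixes h :: "'y \<Rightarrow> 'y \<Rightarrow> 'm::partially_ordered_monoid"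
    and Y :: "'y set" and S :: "'s set" and T :: "'t set" and X :: "'x set" and Z :: "'z set"
    and A B :: "('t \<Rightarrow> 'x) set"
    and \<Lambda> I :: "('t \<Rightarrow> 'x) \<Rightarrow> 'y"
    and lam :: "('t \<Rightarrow> 'x) \<Rightarrow> ('s \<Rightarrow> 'z)"
    and \<phi> :: "('s \<Rightarrow> 'z) \<Rightarrow> 'm"
    and f :: "nat \<Rightarrow> 't \<Rightarrow> 'x"
  assumes "monoid_metric_on Y h"
    and "A \<subseteq> T \<rightarrow>\<^sub>E X"
    and "\<Lambda> \<in> A \<rightarrow> Y" and "I \<in> A \<rightarrow> Y"
    and "lam \<in> A \<rightarrow> (S \<rightarrow>\<^sub>E Z)"
    and a: "\<And>g. g \<in> A \<Longrightarrow> h (\<Lambda> g) (I g) \<le> \<phi> (lam g)"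
    and b: "B \<subseteq> A" "\<And>g. g \<in> B \<Longrightarrow> h (\<Lambda> g) (I g) = \<phi> (lam g)"
    and c: "\<And>n. f n \<in> B" "extremal_seq {\<phi> (lam g) |g. g \<in> A} (\<lambda>n. \<phi> (lam (f n)))"
  shows "extremal_seq {h (\<Lambda> g) (I g) |g. g \<in> A} (\<lambda>n. h (\<Lambda> (f n)) (I (f n)))"
  unfolding extremal_seq_def
proof (intro conjI allI impI ballI)
  show "h (\<Lambda> (f n)) (I (f n)) \<in> {h (\<Lambda> g) (I g) |g. g \<in> A}" for n
    using b(1) c(1) by blast
next
  fix y z
  assume bound: "\<forall>n. h (\<Lambda> (f n)) (I (f n)) \<le> y"
    and "z \<in> {h (\<Lambda> g) (I g) |g. g \<in> A}"
  then obtain g where g: "g \<in> A" "z = h (\<Lambda> g) (I g)"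
    by blast
  \<comment> \<open>By sharpness on \<open>B\<close>, an upper bound of the distances along \<open>f\<close> is also an upper bound
    of the majorants along \<open>f\<close>, hence by extremality of all majorants.\<close>
  have "\<forall>n. \<phi> (lam (f n)) \<le> y"
    using bound b(2) c(1) by simp
  then have "\<phi> (lam g) \<le> y"
    using c(2) g(1) unfolding extremal_seq_def by blast
  with a[OF g(1)] show "z \<le> y"
    unfolding g(2) by (rule order_trans)
qed

end
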